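(* Let $C\in\mathbb{R}^{m\times n}$, $F\in\mathbb{R}^{m\times n}$, let $D\in\mathbb{R}^{m\times m}$ satisfy $D\succ0$, and for each $t\in\mathbb{N}$ let $\Psi_t:\mathbb{R}^m\to\mathcal{P}(\mathbb{R}^m)$ be a set-valued mapping. Suppose that, for each $t\in\mathbb{N}$, there exists a convex, closed and proper function $f_t:\mathbb{R}^m\to\mathbb{R}\cup\{+\infty\}$ such that $\Psi_t(z)=\partial f_t(z)$ for each $z\in\mathbb{R}^m$. Then the generalized equation $$0\in Cx+Du+\Psi_t(Fx+u)$$ admits a unique solution $u\in\mathbb{R}^m$ for each $x\in\mathbb{R}^n$ and each $t\in\mathbb{N}$.
   Context: $\mathcal{P}(S)$ is the power set of $S$; $\partial f$ denotes the convex subdifferential; $D\succ0$ means $D$ is symmetric positive definite. *)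

theory Defs
  imports "HOL-Analysis.Analysis"
begin

text \<open>
  Functions into \<open>\<real> \<union> {+\<infinity>}\<close> are modelled as functions into \<^typ>\<open>ereal\<close>; the exclusion of
  \<open>-\<infinity>\<close> is part of \<open>proper_fun\<close> below. The epigraph lives in \<open>'a \<times> \<real>\<close>, i.e. its second
  component is a finite real, as usual in convex analysis.
\<close>

definition ext_epigraph :: "('a \<Rightarrow> ereal) \<Rightarrow> ('a \<times> real) set" where
  "ext_epigraph f = {(x, r). f x \<le> ereal r}"

definition convex_fun :: "('a::real_vector \<Rightarrow> ereal) \<Rightarrow> bool" where
  "convex_fun f \<longleftrightarrow> convex (ext_epigraph f)"

definition closed_fun :: "('a::topological_space \<Rightarrow> ereal) \<Rightarrow> bool" where
  "closed_fun f \<longleftrightarrow> closed (ext_epigraph f)"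

definition proper_fun :: "('a \<Rightarrow> ereal) \<Rightarrow> bool" where
  "proper_fun f \<longleftrightarrow> (\<forall>x. f x \<noteq> -\<infinity>) \<and> (\<exists>x. f x \<noteq> \<infinity>)"

text \<open>
  For proper \<open>f\<close> the subdifferential is empty at points where \<open>f\<close> is \<open>+\<infinity>\<close>, since the inequality
  then fails at any \<open>y\<close> with \<open>f y\<close> finite.
\<close>

definition subdifferential :: "('a::real_inner \<Rightarrow> ereal) \<Rightarrow> 'a \<Rightarrow> 'a set" where
  "subdifferential f z = {g. \<forall>y. f z + ereal (g \<bullet> (y - z)) \<le> f y}"

definition sym_pos_def :: "real ^ 'n ^ 'n \<Rightarrow> bool" where
  "sym_pos_def A \<longleftrightarrow> transpose A = A \<and> (\<forall>v. v \<noteq> 0 \<longrightarrow> v \<bullet> (A *v v) > 0)"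

end

theory Submission
  imports Defs
begin

text \<open>
  In the variable \<open>z = F x + u\<close> the inclusion reads \<open>-(q + D z) \<in> \<partial>f z\<close> with
  \<open>q = C x - D (F x)\<close>. As \<open>D\<close> is symmetric, \<open>q + D z\<close> is the gradient of the quadratic
  \<open>z \<mapsto> q \<bullet> z + (z \<bullet> D z) / 2\<close>, so this is the optimality condition for minimising
  \<open>f z + q \<bullet> z + (z \<bullet> D z) / 2\<close>.

  Existence therefore amounts to finding a minimiser. A closed proper convex function lies above
  an affine function (\<open>proper_closed_convex_affine_minorant\<close>), and positive definiteness in finite
  dimension gives \<open>v \<bullet> D v \<ge> c * (norm v)\<^sup>2\<close> with \<open>c > 0\<close> (\<open>pos_def_linear_coercive\<close>); the
  quadratic growth outweighs the affine minorant, so sublevel sets are compact. The minimisation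
  is carried out over the epigraph, which is closed and on which the objective
  \<open>r + q \<bullet> z + (z \<bullet> D z) / 2\<close> is a continuous real function. Moving from the
  minimiser along segments of the epigraph gives the optimality condition
  (\<open>quadratic_minimiser_first_order\<close>).

  Uniqueness comes from monotonicity of the subdifferential: for two solutions, with difference
  \<open>d\<close>, it yields \<open>d \<bullet> D d \<le> 0\<close>, hence \<open>d = 0\<close>.
\<close>

text \<open>
  By compactness the quadratic form has a positive minimum on the unit sphere, and it is
  homogeneous of degree two.
\<close>

lemma pos_def_linear_coercive:
  fixes D :: "'a::euclidean_space \<Rightarrow> 'a"
  assumes lin: "linear D" and pos: "\<And>v. v \<noteq> 0 \<Longrightarrow> v \<bullet> D v > 0"
  obtains c where "c > 0" "\<And>v. c * (norm v)\<^sup>2 \<le> v \<bullet> D v"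
proof -
  have "continuous_on (sphere 0 1) (\<lambda>v. v \<bullet> D v)"
    by (intro continuous_on_inner continuous_on_id linear_continuous_on)
      (simp add: linear_linear lin)
  moreover have "sphere (0::'a) 1 \<noteq> {}"
    by simp
  ultimately have "\<exists>w\<in>sphere 0 1. \<forall>v\<in>sphere 0 1. w \<bullet> D w \<le> v \<bullet> D v"
    by (intro continuous_attains_inf compact_sphere)
  then obtain w where w: "w \<in> sphere (0::'a) 1"
      and min: "\<And>v. v \<in> sphere 0 1 \<Longrightarrow> w \<bullet> D w \<le> v \<bullet> D v"
    by blast
  show thesis
  proof
    show "w \<bullet> D w > 0" using w by (intro pos) auto
    fix v :: 'a
    show "(w \<bullet> D w) * (norm v)\<^sup>2 \<le> v \<bullet> D v"
    proof (cases "v = 0")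
      case False
      have "w \<bullet> D w \<le> (v /\<^sub>R norm v) \<bullet> D (v /\<^sub>R norm v)"
        using False by (intro min) simp
      also have "\<dots> = (v \<bullet> D v) / (norm v)\<^sup>2"
        by (simp add: linear_cmul[OF lin] power2_eq_square divide_inverse)
      finally show ?thesis using False by (simp add: pos_le_divide_eq)
    qed (simp add: linear_0[OF lin])
  qed
qed

text \<open>
  A hyperplane strictly separating the epigraph from a point vertically below one of its points
  cannot be vertical, so it is the graph of an affine function, which lies below \<open>f\<close>.
\<close>

lemma proper_closed_convex_affine_minorant:
  fixes f :: "'a::euclidean_space \<Rightarrow> ereal"
  assumes "convex_fun f" "closed_fun f" "proper_fun f"
  obtains a w where "\<And>z r. (z, r) \<in> ext_epigraph f \<Longrightarrow> a + w \<bullet> z \<le> r"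
proof -
  obtain z0 r0 where r0: "f z0 = ereal r0"
    using assms(3) unfolding proper_fun_def by (metis ereal_cases)
  have "(z0, r0 - 1) \<notin> ext_epigraph f"
    by (simp add: ext_epigraph_def r0)
  then obtain p b where p: "p \<bullet> (z0, r0 - 1) < b"
      and sep: "\<And>e. e \<in> ext_epigraph f \<Longrightarrow> b < p \<bullet> e"
    using separating_hyperplane_closed_point[of "ext_epigraph f" "(z0, r0 - 1)"] assms
    unfolding convex_fun_def closed_fun_def by blast
  obtain v s where vs: "p = (v, s)" by (cases p)
  \<comment> \<open>The point and \<open>(z0, r0)\<close> differ only vertically, so separating them forces \<open>s > 0\<close>.\<close>
  have "b < p \<bullet> (z0, r0)"
    by (rule sep) (simp add: ext_epigraph_def r0)
  with p have s: "s > 0" by (simp add: vs algebra_simps)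
  show thesis
  proof
    fix z r assume "(z, r) \<in> ext_epigraph f"
    from sep[OF this] have "b < v \<bullet> z + s * r" by (simp add: vs)
    with s show "b / s + (- v /\<^sub>R s) \<bullet> z \<le> r"
      by (simp add: field_simps)
  qed
qed

text \<open>
  On a sublevel set the quadratic growth bounds \<open>z\<close>; the objective bounds \<open>r\<close> from above and
  the affine minorant bounds it from below. The minimum is thus sought on a compact set.
\<close>

lemma coercive_quadratic_attains_min_on_epigraph:
  fixes f :: "'a::euclidean_space \<Rightarrow> ereal" and D :: "'a \<Rightarrow> 'a"
  assumes f: "convex_fun f" "closed_fun f" "proper_fun f"
    and lin: "linear D" and pos: "\<And>v. v \<noteq> 0 \<Longrightarrow> v \<bullet> D v > 0"
  obtains z r where "(z, r) \<in> ext_epigraph f"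
    "\<And>y s. (y, s) \<in> ext_epigraph f \<Longrightarrow>
       r + q \<bullet> z + z \<bullet> D z / 2 \<le> s + q \<bullet> y + y \<bullet> D y / 2"
proof -
  obtain z0 r0 where r0: "f z0 = ereal r0"
    using f(3) unfolding proper_fun_def by (metis ereal_cases)
  obtain a w where minor: "\<And>z r. (z, r) \<in> ext_epigraph f \<Longrightarrow> a + w \<bullet> z \<le> r"
    using proper_closed_convex_affine_minorant[OF f] by blast
  obtain c where c: "c > 0" "\<And>v. c * (norm v)\<^sup>2 \<le> v \<bullet> D v"
    using pos_def_linear_coercive[OF lin pos] by blast
  define \<phi> where "\<phi> = (\<lambda>e::'a \<times> real. snd e + q \<bullet> fst e + fst e \<bullet> D (fst e) / 2)"
  define M where "M = \<phi> (z0, r0)"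
  define S where "S = ext_epigraph f \<inter> {e. \<phi> e \<le> M}"
  have "continuous_on A (\<lambda>e::'a \<times> real. D (fst e))" for A
    by (rule linear_continuous_on_compose[OF continuous_on_fst[OF continuous_on_id] lin])
  then have cont: "continuous_on A \<phi>" for A
    unfolding \<phi>_def by (intro continuous_intros) auto
  have closed: "closed S"
    unfolding S_def using f(2) cont
    by (intro closed_Int closed_Collect_le) (auto simp: closed_fun_def)
  \<comment> \<open>The radius \<open>R\<close> is such that \<open>norm z > R\<close> gives \<open>norm z > 1\<close> and
    \<open>c * norm z / 2 > k + 1 + \<bar>M - a\<bar>\<close>. Multiplied by \<open>norm z\<close>, the latter makes the quadratic
    exceed \<open>k * norm z + (M - a)\<close>, which is impossible on the sublevel set.\<close>
  define k where "k = norm (w + q)"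
  define R where "R = (k + 1 + \<bar>M - a\<bar>) * 2 / c + 1"
  have bound_z: "norm z \<le> R" if e: "(z, r) \<in> S" for z r
  proof (rule ccontr)
    assume "\<not> norm z \<le> R"
    then have z: "norm z > R" by simp
    have k0: "k \<ge> 0" by (simp add: k_def)
    have "R \<ge> 1" using c(1) k0 by (simp add: R_def)
    with z have z1: "norm z > 1" by simp
    have "(k + 1 + \<bar>M - a\<bar>) * 2 / c < norm z" using z by (simp add: R_def)
    then have "k + 1 + \<bar>M - a\<bar> < c * norm z / 2"
      using c(1) by (simp add: field_simps)
    then have "(k + 1 + \<bar>M - a\<bar>) * norm z < c * norm z / 2 * norm z"
      using z1 by (intro mult_strict_right_mono) auto
    moreover have "\<bar>M - a\<bar> * 1 \<le> \<bar>M - a\<bar> * norm z"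
      using z1 by (intro mult_left_mono) auto
    ultimately have "k * norm z + norm z + (M - a) < c * (norm z)\<^sup>2 / 2"
      by (simp add: power2_eq_square algebra_simps)
    moreover have "a + w \<bullet> z + q \<bullet> z + z \<bullet> D z / 2 \<le> M"
      using e minor[of z r] by (auto simp: S_def \<phi>_def)
    moreover have "\<bar>(w + q) \<bullet> z\<bar> \<le> k * norm z"
      unfolding k_def by (rule Cauchy_Schwarz_ineq2)
    ultimately show False
      using c(2)[of z] z1 by (simp add: inner_add_left)
  qed
  have "bounded S"
  proof (rule bounded_subset)
    define L where "L = \<bar>a\<bar> + norm w * R + \<bar>M\<bar> + norm q * R"
    show "bounded (cball (0::'a) R \<times> {-L..L})"
      by (intro bounded_Times) auto
    show "S \<subseteq> cball 0 R \<times> {-L..L}"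
    proof clarify
      fix z r assume e: "(z, r) \<in> S"
      have z: "norm z \<le> R" by (rule bound_z[OF e])
      have prod: "\<bar>v \<bullet> z\<bar> \<le> norm v * R" for v
        using Cauchy_Schwarz_ineq2[of v z] mult_left_mono[OF z, of "norm v"] by simp
      have "R \<ge> 0" by (rule order_trans[OF norm_ge_zero z])
      then have "norm w * R \<ge> 0" "norm q * R \<ge> 0" by simp_all
      moreover have "a + w \<bullet> z \<le> r" using e minor by (auto simp: S_def)
      moreover have "r + q \<bullet> z + z \<bullet> D z / 2 \<le> M" using e by (simp add: S_def \<phi>_def)
      moreover have "z \<bullet> D z \<ge> 0"
        using pos[of z] by (cases "z = 0") auto
      ultimately have "-L \<le> r" "r \<le> L"
        using prod[of w] prod[of q] by (auto simp: L_def)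
      then show "z \<in> cball 0 R \<and> r \<in> {-L..L}" using z by simp
    qed
  qed
  with closed have "compact S" by (simp add: compact_eq_bounded_closed)
  moreover have "(z0, r0) \<in> S" by (simp add: S_def M_def ext_epigraph_def r0)
  ultimately obtain e where e: "e \<in> S" and min: "\<And>e'. e' \<in> S \<Longrightarrow> \<phi> e \<le> \<phi> e'"
    using continuous_attains_inf[of S \<phi>] cont by blast
  show thesis
  proof
    show "(fst e, snd e) \<in> ext_epigraph f" using e by (simp add: S_def)
    fix y s assume "(y, s) \<in> ext_epigraph f"
    then have "\<phi> e \<le> \<phi> (y, s)"
      using min[of "(y, s)"] e by (cases "\<phi> (y, s) \<le> M") (auto simp: S_def)
    then show "snd e + q \<bullet> fst e + fst e \<bullet> D (fst e) / 2 \<le> s + q \<bullet> y + y \<bullet> D y / 2"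
      by (simp add: \<phi>_def)
  qed
qed

text \<open>
  Along the segment from the minimiser to another point of the convex set the objective changes
  by \<open>t * \<alpha> + t\<^sup>2 * \<beta>\<close>, where \<open>\<alpha>\<close> is the quantity claimed to be nonnegative. The change is nonnegative for all
  small \<open>t > 0\<close>, so \<open>\<alpha> \<ge> 0\<close>. Symmetry of \<open>D\<close> makes the two cross terms equal.
\<close>

lemma quadratic_minimiser_first_order:
  fixes D :: "'a::real_inner \<Rightarrow> 'a"
  assumes "convex E" and lin: "linear D" and sym: "\<And>u v. u \<bullet> D v = D u \<bullet> v"
    and zr: "(z, r) \<in> E"
    and min: "\<And>y s. (y, s) \<in> E \<Longrightarrow>
       r + q \<bullet> z + z \<bullet> D z / 2 \<le> s + q \<bullet> y + y \<bullet> D y / 2"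
    and ys: "(y, s) \<in> E"
  shows "0 \<le> (s - r) + (q + D z) \<bullet> (y - z)"
proof -
  define d where "d = y - z"
  define \<alpha> where "\<alpha> = (s - r) + (q + D z) \<bullet> d"
  define \<beta> where "\<beta> = d \<bullet> D d / 2"
  have segment: "0 \<le> \<alpha> + t * \<beta>" if t: "t \<in> {0<..<1}" for t
  proof -
    have "(1 - t) *\<^sub>R (z, r) + t *\<^sub>R (y, s) \<in> E"
      using t by (intro convexD[OF \<open>convex E\<close>] zr ys) auto
    also have "(1 - t) *\<^sub>R (z, r) + t *\<^sub>R (y, s) = (z + t *\<^sub>R d, r + t * (s - r))"
      by (simp add: d_def algebra_simps)
    finally have "(z + t *\<^sub>R d, r + t * (s - r)) \<in> E" .
    from min[OF this]
    have "0 \<le> t * (s - r) + t * (q \<bullet> d)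
        + ((z + t *\<^sub>R d) \<bullet> D (z + t *\<^sub>R d) - z \<bullet> D z) / 2"
      by (simp add: inner_add_right diff_divide_distrib)
    also have "(z + t *\<^sub>R d) \<bullet> D (z + t *\<^sub>R d)
        = z \<bullet> D z + t * (z \<bullet> D d) + t * (d \<bullet> D z) + t * t * (d \<bullet> D d)"
      by (simp add: linear_add[OF lin] linear_cmul[OF lin] inner_add_left inner_add_right
          distrib_left)
    also have "z \<bullet> D d = D z \<bullet> d" by (rule sym)
    also have "d \<bullet> D z = D z \<bullet> d" by (rule inner_commute)
    finally have "0 \<le> t * (\<alpha> + t * \<beta>)"
      by (simp add: \<alpha>_def \<beta>_def inner_add_left field_simps)
    with t show ?thesis by (simp add: zero_le_mult_iff)
  qed
  have "((\<lambda>t. \<alpha> + t * \<beta>) \<longlongrightarrow> \<alpha> + 0 * \<beta>) (at_right 0)"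
    by (intro tendsto_intros)
  moreover have "\<forall>\<^sub>F t in at_right 0. 0 \<le> \<alpha> + t * \<beta>"
    using eventually_at_right_real[OF zero_less_one] by (rule eventually_mono) (rule segment)
  ultimately have "0 \<le> \<alpha> + 0 * \<beta>"
    by (intro tendsto_lowerbound) auto
  then show ?thesis by (simp add: \<alpha>_def d_def)
qed

lemma subdifferential_finite:
  assumes "proper_fun f" "g \<in> subdifferential f z"
  obtains r where "f z = ereal r"
proof -
  obtain y where "f y \<noteq> \<infinity>" using assms(1) by (auto simp: proper_fun_def)
  moreover have "f z + ereal (g \<bullet> (y - z)) \<le> f y"
    using assms(2) by (auto simp: subdifferential_def)
  ultimately have "f z \<noteq> \<infinity>" by auto
  with assms(1) that show thesis by (cases "f z") (auto simp: proper_fun_def)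
qed

lemma subdifferential_monotone:
  assumes f: "proper_fun f"
    and g: "g \<in> subdifferential f z" and g': "g' \<in> subdifferential f z'"
  shows "0 \<le> (g - g') \<bullet> (z - z')"
proof -
  obtain r r' where "f z = ereal r" "f z' = ereal r'"
    using subdifferential_finite[OF f g] subdifferential_finite[OF f g'] by metis
  moreover have "f z + ereal (g \<bullet> (z' - z)) \<le> f z'" "f z' + ereal (g' \<bullet> (z - z')) \<le> f z"
    using g g' by (auto simp: subdifferential_def)
  ultimately show ?thesis by (simp add: algebra_simps inner_diff_left inner_diff_right)
qed

text \<open>
  This is the generalized equation after the change of variable \<open>z = F x + u\<close>. The minimiser
  found above lies in the epigraph, so its second component \<open>r\<close> satisfies \<open>f z \<le> r\<close>, which is
  the direction in which the subgradient inequality needs it.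
\<close>

lemma ex1_subdifferential_affine_inclusion:
  fixes f :: "'a::euclidean_space \<Rightarrow> ereal" and D :: "'a \<Rightarrow> 'a"
  assumes f: "convex_fun f" "closed_fun f" "proper_fun f"
    and lin: "linear D" and sym: "\<And>u v. u \<bullet> D v = D u \<bullet> v"
    and pos: "\<And>v. v \<noteq> 0 \<Longrightarrow> v \<bullet> D v > 0"
  shows "\<exists>!z. - (q + D z) \<in> subdifferential f z"
proof (rule ex_ex1I)
  obtain z r where zr: "(z, r) \<in> ext_epigraph f"
    and min: "\<And>y s. (y, s) \<in> ext_epigraph f \<Longrightarrow>
       r + q \<bullet> z + z \<bullet> D z / 2 \<le> s + q \<bullet> y + y \<bullet> D y / 2"
    using coercive_quadratic_attains_min_on_epigraph[OF f lin pos] by blast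
  have "f z + ereal (- (q + D z) \<bullet> (y - z)) \<le> f y" for y
  proof (cases "f y")
    case (real s)
    have "0 \<le> (s - r) + (q + D z) \<bullet> (y - z)"
      using quadratic_minimiser_first_order[OF _ lin sym zr min] f(1) real
      by (simp add: convex_fun_def ext_epigraph_def)
    then have "ereal r + ereal (- (q + D z) \<bullet> (y - z)) \<le> f y"
      unfolding real inner_minus_left by simp
    moreover have "f z \<le> ereal r" using zr by (simp add: ext_epigraph_def)
    ultimately show ?thesis by (meson add_right_mono order_trans)
  next
    case MInf
    with f(3) show ?thesis by (simp add: proper_fun_def)
  qed simp
  then show "\<exists>z. - (q + D z) \<in> subdifferential f z"
    by (auto simp: subdifferential_def)
next
  fix z z' assume z: "- (q + D z) \<in> subdifferential f z" "- (q + D z') \<in> subdifferential f z'"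
  have "0 \<le> (- (q + D z) - - (q + D z')) \<bullet> (z - z')"
    by (rule subdifferential_monotone[OF f(3) z])
  also have "\<dots> = - ((z - z') \<bullet> D (z - z'))"
    by (simp add: linear_diff[OF lin] inner_commute algebra_simps inner_diff_left inner_diff_right)
  finally show "z = z'" using pos[of "z - z'"] by fastforce
qed

theorem lemma3:
  fixes C F :: "real ^ 'n ^ 'm"
    and D :: "real ^ 'm ^ 'm"
    and \<Psi> :: "nat \<Rightarrow> real ^ 'm \<Rightarrow> (real ^ 'm) set"
  assumes D: "sym_pos_def D"
    and \<Psi>: "\<forall>t. \<exists>f :: real ^ 'm \<Rightarrow> ereal.
      convex_fun f \<and> closed_fun f \<and> proper_fun f \<and> (\<forall>z. \<Psi> t z = subdifferential f z)"
  shows "\<forall>(x :: real ^ 'n) t. \<exists>!u :: real ^ 'm. 0 \<in> (C *v x + D *v u) +o \<Psi> t (F *v x + u)"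
proof (intro allI)
  fix x :: "real ^ 'n" and t
  obtain f :: "real ^ 'm \<Rightarrow> ereal" where f: "convex_fun f" "closed_fun f" "proper_fun f"
    and \<Psi>_t: "\<And>z. \<Psi> t z = subdifferential f z" using \<Psi> by metis
  define q where "q = C *v x - D *v (F *v x)"
  have sym: "u \<bullet> (D *v v) = (D *v u) \<bullet> v" for u v
    using D by (metis dot_lmul_matrix sym_pos_def_def vector_transpose_matrix)
  have pos: "v \<bullet> (D *v v) > 0" if "v \<noteq> 0" for v
    using D that by (simp add: sym_pos_def_def)
  have "\<exists>!z. - (q + D *v z) \<in> subdifferential f z"
    by (rule ex1_subdifferential_affine_inclusion[OF f _ sym pos]) simp_all
  then obtain z where z: "- (q + D *v z) \<in> subdifferential f z"
    and uniq: "\<And>y. - (q + D *v y) \<in> subdifferential f y \<Longrightarrow> y = z" by blast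
  have shift: "0 \<in> (C *v x + D *v u) +o \<Psi> t (F *v x + u) \<longleftrightarrow>
      - (q + D *v (F *v x + u)) \<in> subdifferential f (F *v x + u)" for u
  proof -
    have "q + D *v (F *v x + u) = C *v x + D *v u"
      by (simp add: q_def matrix_vector_right_distrib)
    then show ?thesis
      by (simp add: set_minus_plus[symmetric] \<Psi>_t)
  qed
  show "\<exists>!u. 0 \<in> (C *v x + D *v u) +o \<Psi> t (F *v x + u)"
  proof
    show "0 \<in> (C *v x + D *v (z - F *v x)) +o \<Psi> t (F *v x + (z - F *v x))"
      unfolding shift using z by simp
    show "u = z - F *v x" if "0 \<in> (C *v x + D *v u) +o \<Psi> t (F *v x + u)" for u
      using uniq[OF that[unfolded shift]] by (simp add: algebra_simps)
  qed
qed

end
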